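(* If $f\in\mathcal D_{\mathrm{rad}}(H_n)$, then $\mathcal Gf$ extends to the holomorphic function $F$ on $\mathbb C^2$ given by $$F(\xi,\lambda)=\int_{H_n}f(x)\,\Phi_{\xi,\lambda}(x^{-1})\,dx\qquad\forall(\xi,\lambda)\in\mathbb C^2.$$
   Context: Let $n\ge 1$. The Heisenberg group is $H_n=\mathbb C^n\times\mathbb R$ with product $(z,t)(w,u)=(z+w,\,t+u+\tfrac12\operatorname{Im}\langle w|z\rangle)$, $\langle w|z\rangle=\sum_j w_j\bar z_j$, so $(z,t)^{-1}=(-z,-t)$; Lebesgue measure $dx=dz\,dt$ is a Haar measure. A function on $H_n$ is radial if invariant under $(z,t)\mapsto(kz,t)$, $k\in U(n)$. $\mathcal D_{\mathrm{rad}}(H_n)$ is the space of smooth compactly supported radial functions on $H_n$. Spherical functions: for $(\xi,\lambda)\in\mathbb C^2$, $$\Phi_{\xi,\lambda}(z,t)=e^{i\lambda t}e^{-\lambda|z|^2/4}\Big(1+\sum_{k\ge1}\frac{|z|^{2k}}{(n)_k\,k!\,4^k}\prod_{d=0}^{k-1}\big(\lambda(2d+n)-\xi\big)\Big),\qquad (n)_k=n(n+1)\cdots(n+k-1).$$ Heisenberg fan: $\Sigma=\{(\xi,\lambda)\in\mathbb R^2:\lambda\neq0,\ \xi=|\lambda|(2j+n),\ j\in\mathbb N\}\cup\{(\xi,0):\xi\ge0\}$, with $0\in\mathbb N$. For radial $f\in L^1(H_n)$, the spherical transform is $\mathcal Gf(\xi,\lambda)=\int_{H_n}f(x)\Phi_{\xi,\lambda}(x^{-1})\,dx$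 for $(\xi,\lambda)\in\Sigma$. *)

theory Defs
  imports "HOL-Analysis.Analysis"
begin

text \<open>The Heisenberg group over \<open>\<complex>\<^sup>n \<times> \<real>\<close> with \<open>n = CARD('n)\<close>. The library's
  measure \<^const>\<open>lborel\<close> on this product space is Lebesgue measure \<open>dz dt\<close>, and
  \<^const>\<open>norm\<close> on \<^typ>\<open>complex ^ 'n\<close> is the Euclidean norm.\<close>

type_synonym 'n heis = "(complex ^ 'n) \<times> real"

definition herm :: "complex ^ 'n \<Rightarrow> complex ^ 'n \<Rightarrow> complex"
  where "herm w z = (\<Sum>j\<in>UNIV. w $ j * cnj (z $ j))"

definition heis_mult :: "'n::finite heis \<Rightarrow> 'n heis \<Rightarrow> 'n heis"
  where "heis_mult x y =
    (fst x + fst y, snd x + snd y + 1/2 * Im (herm (fst y) (fst x)))"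

definition heis_inv :: "'n::finite heis \<Rightarrow> 'n heis"
  where "heis_inv x = (- fst x, - snd x)"

lemma heis_mult_assoc: "heis_mult (heis_mult x y) w = heis_mult x (heis_mult y w)"
  by (simp add: heis_mult_def herm_def algebra_simps sum.distrib)

lemma heis_mult_zero: "heis_mult 0 x = x" "heis_mult x 0 = x"
  by (simp_all add: heis_mult_def herm_def)

lemma heis_mult_inv: "heis_mult (heis_inv x) x = 0" "heis_mult x (heis_inv x) = 0"
  by (simp_all add: heis_mult_def heis_inv_def herm_def sum_negf prod_eq_iff
      complex_mult_cnj mult.commute)

definition unitary_matrix :: "complex ^ 'n ^ 'n \<Rightarrow> bool"
  where "unitary_matrix U \<longleftrightarrow>
    (\<chi> i j. cnj (U $ j $ i)) ** U = mat 1 \<and> U ** (\<chi> i j. cnj (U $ j $ i)) = mat 1"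

definition radial :: "('n::finite heis \<Rightarrow> complex) \<Rightarrow> bool"
  where "radial f \<longleftrightarrow> (\<forall>U z t. unitary_matrix U \<longrightarrow> f (U *v z, t) = f (z, t))"

text \<open>\<open>C\<^sup>k\<close> functions on the whole space (real differentiability): the recursion asks that all
  directional derivatives are \<open>C\<^sup>k\<close>.\<close>

primrec Ck :: "nat \<Rightarrow> ('a::real_normed_vector \<Rightarrow> 'b::real_normed_vector) \<Rightarrow> bool"
  where
    "Ck 0 f \<longleftrightarrow> continuous_on UNIV f"
  | "Ck (Suc k) f \<longleftrightarrow>
      (\<forall>x. f differentiable (at x)) \<and> (\<forall>v. Ck k (\<lambda>x. frechet_derivative f (at x) v))"

definition smooth :: "('a::real_normed_vector \<Rightarrow> 'b::real_normed_vector) \<Rightarrow> bool"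
  where "smooth f \<longleftrightarrow> (\<forall>k. Ck k f)"

definition D_rad :: "('n::finite heis \<Rightarrow> complex) set"
  where "D_rad = {f. smooth f \<and> compact (closure {x. f x \<noteq> 0}) \<and> radial f}"

text \<open>The parameter called lambda in the literature is written \<open>\<mu>\<close>. The sum over \<open>k \<ge> 1\<close>
  appears as a sum over \<open>Suc k\<close>.\<close>

definition sph_coeff :: "nat \<Rightarrow> complex \<Rightarrow> complex \<Rightarrow> real \<Rightarrow> nat \<Rightarrow> complex"
  where "sph_coeff n \<xi> \<mu> r k =
    of_real (r ^ (2 * k)) / (pochhammer (of_nat n) k * fact k * 4 ^ k)
      * (\<Prod>d<k. \<mu> * of_nat (2 * d + n) - \<xi>)"

definition sph_fun :: "complex \<Rightarrow> complex \<Rightarrow> 'n::finite heis \<Rightarrow> complex"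
  where "sph_fun \<xi> \<mu> x =
    exp (\<i> * \<mu> * of_real (snd x)) * exp (- \<mu> * of_real ((norm (fst x))\<^sup>2) / 4)
      * (1 + (\<Sum>k. sph_coeff CARD('n) \<xi> \<mu> (norm (fst x)) (Suc k)))"

text \<open>The series defining the spherical functions converges for all parameters.\<close>

lemma summable_sph_coeff:
  assumes "n \<ge> 1"
  shows "summable (sph_coeff n \<xi> \<mu> r)"
proof -
  define C where "C = r\<^sup>2 * (2 * norm \<mu> + norm \<xi>)"
  have C0: "C \<ge> 0" by (simp add: C_def)
  obtain N where N: "real N > C" using reals_Archimedean2 by blast
  show ?thesis
  proof (rule summable_ratio_test[of "1/2" N])
    fix k assume k: "N \<le> k"
    let ?q = "of_real (r\<^sup>2) * (\<mu> * of_nat (2 * k + n) - \<xi>)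
                / (of_nat (n + k) * of_nat (Suc k) * 4) :: complex"
    have "sph_coeff n \<xi> \<mu> r (Suc k) = ?q * sph_coeff n \<xi> \<mu> r k"
      by (simp add: sph_coeff_def pochhammer_Suc power2_eq_square mult_ac del: of_nat_Suc)
    then have "norm (sph_coeff n \<xi> \<mu> r (Suc k)) = norm ?q * norm (sph_coeff n \<xi> \<mu> r k)"
      by (simp only: norm_mult)
    moreover have "norm ?q \<le> 1/2"
    proof -
      have "norm (\<mu> * of_nat (2 * k + n) - \<xi>) \<le> norm \<mu> * real (2 * k + n) + norm \<xi>"
        by (rule order_trans[OF norm_triangle_ineq4]) (simp only: norm_mult norm_of_nat order_refl)
      also have "\<dots> \<le> norm \<mu> * (2 * real (n + k)) + norm \<xi> * real (n + k)"
        using assms by (intro add_mono mult_left_mono) (auto simp: mult_le_cancel_left1)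
      finally have "r\<^sup>2 * norm (\<mu> * of_nat (2 * k + n) - \<xi>) \<le> C * real (n + k)"
        unfolding C_def by (simp only: mult.assoc) (intro mult_left_mono; simp add: algebra_simps)
      also have "\<dots> \<le> real (Suc k) * real (n + k)"
        using N k by (intro mult_right_mono) auto
      finally have *: "r\<^sup>2 * norm (\<mu> * of_nat (2 * k + n) - \<xi>) \<le> real (Suc k) * real (n + k)" .
      have eq: "norm ?q = r\<^sup>2 * norm (\<mu> * of_nat (2 * k + n) - \<xi>)
                / (real (n + k) * real (Suc k) * 4)"
        by (simp only: norm_divide norm_mult norm_of_nat norm_of_real norm_numeral) simp
      have pos: "real (n + k) * real (Suc k) * 4 > 0" using assms by simp
      have "r\<^sup>2 * norm (\<mu> * of_nat (2 * k + n) - \<xi>) \<le> 1/2 * (real (n + k) * real (Suc k) * 4)"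
        using * pos by (simp only: mult.commute)
      then show ?thesis unfolding eq using pos by (simp only: pos_divide_le_eq)
    qed
    ultimately show "norm (sph_coeff n \<xi> \<mu> r (Suc k)) \<le> 1/2 * norm (sph_coeff n \<xi> \<mu> r k)"
      by (metis mult_right_mono norm_ge_zero)
  qed simp
qed

definition heis_fan :: "nat \<Rightarrow> (real \<times> real) set"
  where "heis_fan n =
    {(\<xi>, \<mu>). \<mu> \<noteq> 0 \<and> (\<exists>j::nat. \<xi> = \<bar>\<mu>\<bar> * real (2 * j + n))} \<union> {(\<xi>, \<mu>). \<mu> = 0 \<and> \<xi> \<ge> 0}"

text \<open>Meaningful for radial integrable \<open>f\<close> and parameters in \<^const>\<open>heis_fan\<close>.\<close>

definition sph_transform :: "('n::finite heis \<Rightarrow> complex) \<Rightarrow> real \<times> real \<Rightarrow> complex"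
  where "sph_transform f p =
    (LINT x|lborel. f x * sph_fun (of_real (fst p)) (of_real (snd p)) (heis_inv x))"

text \<open>Complex (Frechet) differentiability of a function of two complex variables: the real
  derivative exists at every point and is \<open>\<complex>\<close>-linear.\<close>

definition holomorphic2 :: "(complex \<times> complex \<Rightarrow> complex) \<Rightarrow> bool"
  where "holomorphic2 F \<longleftrightarrow>
    (\<forall>p. \<exists>a b. (F has_derivative (\<lambda>h. a * fst h + b * snd h)) (at p))"

end

theory Submission imports Defs begin

text \<open>The function \<open>f\<close> is continuous with compact support, so the integral can be
  differentiated under the integral sign once the spherical functions have partial derivatives in
  \<open>\<xi>\<close> and \<open>\<mu>\<close> that are jointly continuous in the parameters and the point.
  Consecutive terms of the defining series differ by a factor that is affine in
  \<open>(\<xi>, \<mu>)\<close>; on bounded sets this factor and its partial derivatives are at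
  most \<open>C / (k + 1)\<close>. Hence the terms and their partial derivatives are all dominated by
  \<open>(2 C)\<^sup>k / k!\<close>, and the Weierstrass M-test allows termwise
  differentiation.\<close>

section \<open>Differentiation under the integral sign\<close>

text \<open>The Leibniz rule takes derivatives as bounded operators, whereas
  \<open>holomorphic2\<close> speaks of plain maps given by two coefficients; \<open>grad\<close>
  translates between the two.\<close>

definition grad :: "complex \<Rightarrow> complex \<Rightarrow> (complex \<times> complex) \<Rightarrow>\<^sub>L complex"
  where "grad a b = Blinfun (\<lambda>h. a * fst h + b * snd h)"

lemma grad_apply: "blinfun_apply (grad a b) = (\<lambda>h. a * fst h + b * snd h)"
  unfolding grad_def
  by (intro bounded_linear_Blinfun_apply bounded_linear_add
      bounded_linear_compose[OF bounded_linear_mult_right]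
      bounded_linear_fst bounded_linear_snd)

lemma norm_grad_apply_le:
  fixes a b :: complex and h :: "complex \<times> complex"
  shows "norm (a * fst h + b * snd h) \<le> (norm a + norm b) * norm h"
proof -
  have "norm (a * fst h + b * snd h) \<le> norm a * norm (fst h) + norm b * norm (snd h)"
    by (rule order_trans[OF norm_triangle_ineq]) (simp add: norm_mult)
  also have "\<dots> \<le> norm a * norm h + norm b * norm h"
    using norm_fst_le[of "fst h" "snd h"] norm_snd_le[of "snd h" "fst h"]
    by (intro add_mono mult_left_mono) auto
  finally show ?thesis by (simp add: algebra_simps)
qed

text \<open>Linear and bounded dependence on the coefficients turns their continuity into continuity
  in operator norm, which the Leibniz rule asks for.\<close>

lemma bounded_linear_grad: "bounded_linear (\<lambda>ab. grad (fst ab) (snd ab))"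
proof (rule bounded_linear_intro[where K=2])
  fix x y :: "complex \<times> complex" and r :: real
  show "grad (fst (x + y)) (snd (x + y)) = grad (fst x) (snd x) + grad (fst y) (snd y)"
    by (rule blinfun_eqI) (simp add: grad_apply blinfun.add_left algebra_simps)
  show "grad (fst (r *\<^sub>R x)) (snd (r *\<^sub>R x)) = r *\<^sub>R grad (fst x) (snd x)"
    by (rule blinfun_eqI) (simp add: grad_apply blinfun.scaleR_left algebra_simps)
  have "norm (grad (fst x) (snd x)) \<le> norm (fst x) + norm (snd x)"
    by (rule norm_blinfun_bound) (simp_all add: grad_apply norm_grad_apply_le)
  also have "\<dots> \<le> norm x * 2"
    using norm_fst_le[of "fst x" "snd x"] norm_snd_le[of "snd x" "fst x"] by simp
  finally show "norm (grad (fst x) (snd x)) \<le> norm x * 2" .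
qed

lemma continuous_on_grad:
  assumes "continuous_on S a" "continuous_on S b"
  shows "continuous_on S (\<lambda>x. grad (a x) (b x))"
  using bounded_linear.continuous_on[OF bounded_linear_grad continuous_on_Pair[OF assms]] by simp

lemma integrable_lborel_compact_support:
  fixes g :: "'a::euclidean_space \<Rightarrow> complex"
  assumes "compact K" "continuous_on UNIV g" "\<And>x. x \<notin> K \<Longrightarrow> g x = 0"
  shows "integrable lborel g"
proof -
  have "integrable lborel (\<lambda>x. indicator K x *\<^sub>R g x)"
    by (rule borel_integrable_compact[OF assms(1)]) (rule continuous_on_subset[OF assms(2)], simp)
  also have "(\<lambda>x. indicator K x *\<^sub>R g x) = g"
    using assms(3) by (auto simp: fun_eq_iff indicator_def)
  finally show ?thesis .
qed

text \<open>All integrands vanish off one compact set, so the integrals run over one fixed box.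
  There the Leibniz rule applies, because \<open>a\<close> and \<open>b\<close> are continuous
  jointly in parameters and point.\<close>

lemma holomorphic2_integral:
  fixes G :: "complex \<times> complex \<Rightarrow> 'x::euclidean_space \<Rightarrow> complex"
  assumes K: "compact K" "\<And>p x. x \<notin> K \<Longrightarrow> G p x = 0"
    and G: "\<And>p. continuous_on UNIV (G p)"
    and deriv: "\<And>p x. ((\<lambda>p. G p x) has_derivative (\<lambda>h. a (p, x) * fst h + b (p, x) * snd h)) (at p)"
    and cont: "continuous_on UNIV a" "continuous_on UNIV b"
  shows "holomorphic2 (\<lambda>p. LINT x|lborel. G p x)"
  unfolding holomorphic2_def
proof
  fix p0
  obtain l u where lu: "K \<subseteq> cbox l u"
    using bounded_subset_cbox_symmetric compact_imp_bounded[OF K(1)] by metis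
  let ?D = "\<lambda>p x. grad (a (p, x)) (b (p, x))"
  have int: "(LINT x|lborel. G p x) = integral (cbox l u) (G p)" for p
  proof -
    have "(LINT x|lborel. G p x) = integral UNIV (G p)"
      by (intro integral_lborel[symmetric] integrable_lborel_compact_support[OF K(1) G] K(2))
    also have "\<dots> = integral UNIV (\<lambda>x. if x \<in> cbox l u then G p x else 0)"
      using K(2)[of _ p] lu by (intro integral_cong) (simp, blast)
    finally show ?thesis by (simp add: integral_restrict_UNIV)
  qed
  have D: "continuous_on S (\<lambda>(p, x). ?D p x)" for S
    unfolding split_def prod.collapse
    by (rule continuous_on_subset[OF continuous_on_grad[OF cont]]) simp
  have "((\<lambda>p. integral (cbox l u) (G p)) has_derivative integral (cbox l u) (?D p0))
      (at p0 within UNIV)"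
    by (intro leibniz_rule D)
       (auto simp: grad_apply deriv intro!: integrable_continuous continuous_on_subset[OF G])
  moreover have "blinfun_apply (integral (cbox l u) (?D p0)) =
      (\<lambda>h. integral (cbox l u) (\<lambda>x. a (p0, x)) * fst h + integral (cbox l u) (\<lambda>x. b (p0, x)) * snd h)"
  proof
    fix h
    have c: "continuous_on (cbox l u) (\<lambda>x. (p0, x))" by (intro continuous_intros)
    have ia: "(\<lambda>x. a (p0, x)) integrable_on cbox l u"
      by (intro integrable_continuous continuous_on_compose2[OF cont(1) c]) auto
    have ib: "(\<lambda>x. b (p0, x)) integrable_on cbox l u"
      by (intro integrable_continuous continuous_on_compose2[OF cont(2) c]) auto
    have iD: "?D p0 integrable_on cbox l u"
      by (intro integrable_continuous continuous_on_grad
          continuous_on_compose2[OF cont(1) c] continuous_on_compose2[OF cont(2) c]) auto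
    \<comment> \<open>Evaluation at \<open>h\<close> is bounded linear on operators and hence
      commutes with the integral.\<close>
    have "blinfun_apply (integral (cbox l u) (?D p0)) h
        = integral (cbox l u) (\<lambda>x. a (p0, x) * fst h + b (p0, x) * snd h)"
      using integral_linear[OF iD blinfun.bounded_linear_left[of h]]
      by (simp add: o_def grad_apply)
    also have "\<dots> = integral (cbox l u) (\<lambda>x. a (p0, x)) * fst h
        + integral (cbox l u) (\<lambda>x. b (p0, x)) * snd h"
      using ia ib by (subst integral_add) (auto intro: integrable_on_mult_left)
    finally show "blinfun_apply (integral (cbox l u) (?D p0)) h = \<dots>" .
  qed
  ultimately show "\<exists>A B. ((\<lambda>p. LINT x|lborel. G p x) has_derivative
      (\<lambda>h. A * fst h + B * snd h)) (at p0)"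
    unfolding int by auto
qed

section \<open>Terms of the series, their partial derivatives and bounds\<close>

text \<open>Quotient of consecutive terms of the spherical series. It is complex linear in
  \<open>p\<close>, so its partial derivatives are its values at \<open>(1, 0)\<close> and
  \<open>(0, 1)\<close>.\<close>

definition sph_ratio :: "nat \<Rightarrow> nat \<Rightarrow> (complex \<times> complex) \<Rightarrow> real \<Rightarrow> complex"
  where "sph_ratio n k p s = of_real s * (snd p * of_nat (2 * k + n) - fst p)
    / (of_nat (n + k) * of_nat (Suc k) * 4)"

text \<open>An argument \<open>((\<xi>, \<mu>), s)\<close> stands for the parameters together with
  \<open>s = r\<^sup>2\<close>.\<close>

primrec sph_term :: "nat \<Rightarrow> nat \<Rightarrow> (complex \<times> complex) \<times> real \<Rightarrow> complex"
  where
    "sph_term n 0 y = 1"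
  | "sph_term n (Suc k) y = sph_ratio n k (fst y) (snd y) * sph_term n k y"

text \<open>Product rule along the recursion of \<open>sph_term\<close>, for the first parameter;
  \<open>sph_term_mu\<close> does the same for the second.\<close>

primrec sph_term_xi :: "nat \<Rightarrow> nat \<Rightarrow> (complex \<times> complex) \<times> real \<Rightarrow> complex"
  where
    "sph_term_xi n 0 y = 0"
  | "sph_term_xi n (Suc k) y = sph_ratio n k (1, 0) (snd y) * sph_term n k y
      + sph_ratio n k (fst y) (snd y) * sph_term_xi n k y"

primrec sph_term_mu :: "nat \<Rightarrow> nat \<Rightarrow> (complex \<times> complex) \<times> real \<Rightarrow> complex"
  where
    "sph_term_mu n 0 y = 0"
  | "sph_term_mu n (Suc k) y = sph_ratio n k (0, 1) (snd y) * sph_term n k y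
      + sph_ratio n k (fst y) (snd y) * sph_term_mu n k y"

lemma sph_ratio_linear:
  "sph_ratio n k p s = sph_ratio n k (1, 0) s * fst p + sph_ratio n k (0, 1) s * snd p"
  by (simp add: sph_ratio_def diff_divide_distrib algebra_simps)

lemma sph_term_has_derivative:
  "((\<lambda>p. sph_term n k (p, s)) has_derivative
    (\<lambda>h. sph_term_xi n k (p, s) * fst h + sph_term_mu n k (p, s) * snd h)) (at p within S)"
proof (induction k)
  case (Suc k)
  have "((\<lambda>p. sph_ratio n k p s) has_derivative (\<lambda>h. sph_ratio n k h s)) (at p within S)"
    by (subst (1 2) sph_ratio_linear) (auto intro!: derivative_eq_intros)
  from has_derivative_mult[OF this Suc.IH]
  moreover have "sph_ratio n k p s * (sph_term_xi n k (p, s) * fst h + sph_term_mu n k (p, s) * snd h)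
      + sph_ratio n k h s * sph_term n k (p, s)
    = sph_term_xi n (Suc k) (p, s) * fst h + sph_term_mu n (Suc k) (p, s) * snd h" for h
    by (subst (2) sph_ratio_linear) (simp add: algebra_simps)
  ultimately show ?case by simp
qed simp

lemma continuous_on_sph_term:
  "continuous_on S (sph_term n k)" "continuous_on S (sph_term_xi n k)"
  "continuous_on S (sph_term_mu n k)"
proof -
  have r: "continuous_on S (\<lambda>y. sph_ratio n k (f y) (g y))"
    if "continuous_on S f" "continuous_on S g" for S k f and g :: "(complex \<times> complex) \<times> real \<Rightarrow> real"
    unfolding sph_ratio_def divide_inverse using that by (intro continuous_intros)
  show 1: "continuous_on S (sph_term n k)" for k
    by (induction k) (auto intro!: continuous_intros r)
  show "continuous_on S (sph_term_xi n k)"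
    by (induction k) (auto intro!: continuous_intros r 1)
  show "continuous_on S (sph_term_mu n k)"
    by (induction k) (auto intro!: continuous_intros r 1)
qed

text \<open>The linear form in \<open>p\<close> has norm at most \<open>M * (2 * k + n + 1)\<close>.
  Since \<open>n \<ge> 1\<close>, the factor \<open>4 * (n + k)\<close> of the denominator absorbs
  the growth in \<open>k\<close>, and \<open>Suc k\<close> is left over.\<close>

lemma norm_sph_ratio_le:
  assumes "n \<ge> 1" "norm p \<le> M" "\<bar>s\<bar> \<le> R"
  shows "norm (sph_ratio n k p s) \<le> R * M / real (Suc k)"
proof -
  have M: "norm (fst p) \<le> M" "norm (snd p) \<le> M"
    using assms(2) norm_fst_le[of "fst p" "snd p"] norm_snd_le[of "snd p" "fst p"] by auto
  then have M0: "M \<ge> 0" by (meson norm_ge_zero order_trans)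
  have R0: "R \<ge> 0" using assms(3) by linarith
  have "norm (snd p * of_nat (2 * k + n) - fst p) \<le> M * real (2 * k + n) + M"
    by (rule order_trans[OF norm_triangle_ineq4])
       (unfold norm_mult norm_of_nat, intro add_mono mult_right_mono M, simp)
  also have "\<dots> = M * real (2 * k + n + 1)" by (simp add: algebra_simps)
  also have "\<dots> \<le> M * real ((n + k) * 4)"
    using assms(1) M0 by (intro mult_left_mono) auto
  finally have "\<bar>s\<bar> * norm (snd p * of_nat (2 * k + n) - fst p) \<le> R * (M * real ((n + k) * 4))"
    using assms(3) R0 by (intro mult_mono) auto
  moreover have "norm (sph_ratio n k p s) = \<bar>s\<bar> * norm (snd p * of_nat (2 * k + n) - fst p)
      / (real ((n + k) * 4) * real (Suc k))"
    unfolding sph_ratio_def norm_divide norm_mult norm_of_nat norm_of_real norm_numeral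
    by (simp add: mult_ac)
  moreover have "R * M / real (Suc k) = R * (M * real ((n + k) * 4)) / (real ((n + k) * 4) * real (Suc k))"
    using assms(1) by simp
  ultimately show ?thesis by (simp only: divide_right_mono of_nat_0_le_iff mult_nonneg_nonneg)
qed

text \<open>A step of the derivative recursions adds two products, each at most
  \<open>R * M / Suc k\<close> times the previous bound; hence the 2 in the base. The derivative
  steps also use the bound on the terms, so all three go through one induction.\<close>

lemma norm_sph_term_le:
  assumes "n \<ge> 1" "norm (fst y) \<le> M" "M \<ge> 1" "\<bar>snd y\<bar> \<le> R"
  shows "norm (sph_term n k y) \<le> (2 * (R * M)) ^ k / fact k \<and>
    norm (sph_term_xi n k y) \<le> (2 * (R * M)) ^ k / fact k \<and>
    norm (sph_term_mu n k y) \<le> (2 * (R * M)) ^ k / fact k"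
proof (induction k)
  case (Suc k)
  let ?C = "R * M" and ?e = "(2 * (R * M)) ^ k / fact k"
  have C0: "?C \<ge> 0" using assms by (intro mult_nonneg_nonneg) auto
  have *: "norm (sph_ratio n k p (snd y) * v) \<le> ?C / real (Suc k) * ?e"
    if "norm p \<le> M" "norm v \<le> ?e" for p v
    unfolding norm_mult using norm_sph_ratio_le[OF assms(1) that(1) assms(4)] that(2) C0
    by (intro mult_mono) auto
  have step: "?C / real (Suc k) * ?e + ?C / real (Suc k) * ?e = (2 * ?C) ^ Suc k / fact (Suc k)"
    by (simp add: field_simps del: of_nat_Suc)
  \<comment> \<open>Here \<open>M \<ge> 1\<close> enters: the ratio bound must also cover the unit
    directions that come from the product rule.\<close>
  have unit: "norm (1 :: complex, 0 :: complex) \<le> M" "norm (0 :: complex, 1 :: complex) \<le> M"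
    using assms(3) by (simp_all add: norm_Pair)
  note IH = Suc.IH[THEN conjunct1] Suc.IH[THEN conjunct2, THEN conjunct1]
    Suc.IH[THEN conjunct2, THEN conjunct2]
  have nn: "?C / real (Suc k) * ?e \<ge> 0" using C0 by simp
  \<comment> \<open>There is only one product here; the second summand is nonnegative and merely
    pads to the common bound.\<close>
  have "norm (sph_term n (Suc k) y) \<le> ?C / real (Suc k) * ?e + ?C / real (Suc k) * ?e"
    unfolding sph_term.simps using *[OF assms(2) IH(1)] nn by linarith
  moreover have "norm (sph_term_xi n (Suc k) y) \<le> ?C / real (Suc k) * ?e + ?C / real (Suc k) * ?e"
    unfolding sph_term_xi.simps
    by (rule norm_triangle_le[OF add_mono[OF *[OF unit(1) IH(1)] *[OF assms(2) IH(2)]]])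
  moreover have "norm (sph_term_mu n (Suc k) y) \<le> ?C / real (Suc k) * ?e + ?C / real (Suc k) * ?e"
    unfolding sph_term_mu.simps
    by (rule norm_triangle_le[OF add_mono[OF *[OF unit(2) IH(1)] *[OF assms(2) IH(3)]]])
  ultimately show ?case unfolding step by blast
qed (use assms in auto)

section \<open>The sum of the series and its derivative\<close>

definition sph_series :: "nat \<Rightarrow> (complex \<times> complex) \<times> real \<Rightarrow> complex"
  where "sph_series n y = (\<Sum>k. sph_term n k y)"

definition sph_series_xi :: "nat \<Rightarrow> (complex \<times> complex) \<times> real \<Rightarrow> complex"
  where "sph_series_xi n y = (\<Sum>k. sph_term_xi n k y)"

definition sph_series_mu :: "nat \<Rightarrow> (complex \<times> complex) \<times> real \<Rightarrow> complex"
  where "sph_series_mu n y = (\<Sum>k. sph_term_mu n k y)"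

lemma summable_exp_bound: "summable (\<lambda>k. (x::real) ^ k / fact k)"
  using summable_exp[of x] by (simp add: divide_inverse mult.commute)

text \<open>With one radius \<open>M\<close> for the parameters and for \<open>s\<close>, the term
  bounds no longer depend on \<open>y\<close> and form an exponential series, so the M-test
  applies.\<close>

lemma uniform_limit_sph_series:
  assumes "n \<ge> 1" "M \<ge> 1"
  defines "S \<equiv> ball 0 M \<times> ball 0 M"
  shows "uniform_limit S (\<lambda>m y. \<Sum>k<m. sph_term n k y) (sph_series n) sequentially"
    and "uniform_limit S (\<lambda>m y. \<Sum>k<m. sph_term_xi n k y) (sph_series_xi n) sequentially"
    and "uniform_limit S (\<lambda>m y. \<Sum>k<m. sph_term_mu n k y) (sph_series_mu n) sequentially"
proof -
  have b: "norm (sph_term n k y) \<le> (2 * (M * M)) ^ k / fact k"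
    "norm (sph_term_xi n k y) \<le> (2 * (M * M)) ^ k / fact k"
    "norm (sph_term_mu n k y) \<le> (2 * (M * M)) ^ k / fact k" if "y \<in> S" for k y
    using norm_sph_term_le[of n y M M k] that assms by (auto simp: S_def)
  show "uniform_limit S (\<lambda>m y. \<Sum>k<m. sph_term n k y) (sph_series n) sequentially"
    unfolding sph_series_def by (rule Weierstrass_m_test[OF b(1) summable_exp_bound])
  show "uniform_limit S (\<lambda>m y. \<Sum>k<m. sph_term_xi n k y) (sph_series_xi n) sequentially"
    unfolding sph_series_xi_def by (rule Weierstrass_m_test[OF b(2) summable_exp_bound])
  show "uniform_limit S (\<lambda>m y. \<Sum>k<m. sph_term_mu n k y) (sph_series_mu n) sequentially"
    unfolding sph_series_mu_def by (rule Weierstrass_m_test[OF b(3) summable_exp_bound])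
qed

lemma ball_Times_ball_exhaust:
  fixes y :: "'a::real_normed_vector \<times> 'b::real_normed_vector"
  obtains M where "M \<ge> 1" "y \<in> ball 0 M \<times> ball 0 M"
proof
  show "1 \<le> 1 + norm y" by simp
  show "y \<in> ball 0 (1 + norm y) \<times> ball 0 (1 + norm y)"
    using norm_fst_le[of "fst y" "snd y"] norm_snd_le[of "snd y" "fst y"]
    by (simp add: mem_Times_iff)
qed

text \<open>Continuity is local: every point lies in a product of open balls on which the sum is a
  uniform limit of continuous partial sums.\<close>

lemma continuous_on_UNIV_sph_series:
  assumes "n \<ge> 1"
  shows "continuous_on UNIV (sph_series n)" "continuous_on UNIV (sph_series_xi n)"
    "continuous_on UNIV (sph_series_mu n)"
proof -
  have local: "continuous_on UNIV g"
    if "\<And>M. M \<ge> 1 \<Longrightarrow> uniform_limit (ball 0 M \<times> ball 0 M) (\<lambda>m y. \<Sum>k<m. t k y) g sequentially"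
      and "\<And>k S. continuous_on S (t k)"
    for t and g :: "(complex \<times> complex) \<times> real \<Rightarrow> complex"
    unfolding continuous_on_eq_continuous_at[OF open_UNIV]
  proof
    fix y :: "(complex \<times> complex) \<times> real"
    obtain M where M: "M \<ge> 1" "y \<in> ball 0 M \<times> ball 0 M" by (rule ball_Times_ball_exhaust)
    have "continuous_on (ball 0 M \<times> ball 0 M) g"
      by (rule uniform_limit_theorem[OF _ that(1)[OF M(1)]])
         (auto intro!: always_eventually continuous_on_sum that(2))
    then show "isCont g y"
      using M(2) continuous_on_eq_continuous_at open_Times open_ball by metis
  qed
  show "continuous_on UNIV (sph_series n)"
    by (rule local[OF uniform_limit_sph_series(1)[OF assms] continuous_on_sph_term(1)])
  show "continuous_on UNIV (sph_series_xi n)"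
    by (rule local[OF uniform_limit_sph_series(2)[OF assms] continuous_on_sph_term(2)])
  show "continuous_on UNIV (sph_series_mu n)"
    by (rule local[OF uniform_limit_sph_series(3)[OF assms] continuous_on_sph_term(3)])
qed

text \<open>Termwise differentiation with \<open>s\<close> frozen: on a convex ball it suffices that
  the series converges and the differentiated series converges uniformly.\<close>

lemma sph_series_has_derivative:
  assumes "n \<ge> 1"
  shows "((\<lambda>p. sph_series n (p, s)) has_derivative
    (\<lambda>h. sph_series_xi n (p, s) * fst h + sph_series_mu n (p, s) * snd h)) (at p)"
proof -
  obtain M where M: "M \<ge> 1" "(p, s) \<in> ball 0 M \<times> ball 0 M" by (rule ball_Times_ball_exhaust)
  let ?S = "ball (0 :: complex \<times> complex) M"
  note lim = uniform_limit_sph_series[OF assms M(1)]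
  have sums: "(\<lambda>k. sph_term n k (q, s)) sums sph_series n (q, s)" if "q \<in> ?S" for q
    unfolding sums_def using tendsto_uniform_limitI[OF lim(1)] that M(2) by auto
  \<comment> \<open>The library rule yields only some sum function \<open>g\<close>; uniqueness of
    sums later identifies it with \<open>sph_series\<close> on the ball.\<close>
  have "\<exists>g. \<forall>q\<in>?S. (\<lambda>k. sph_term n k (q, s)) sums g q \<and>
    (g has_derivative (\<lambda>h. sph_series_xi n (q, s) * fst h + sph_series_mu n (q, s) * snd h))
      (at q within ?S)"
  proof (rule has_derivative_series[OF convex_ball sph_term_has_derivative _ _ sums])
    fix e :: real assume "e > 0"
    \<comment> \<open>Each of the two partial derivatives gets half of the error;
      \<open>norm_grad_apply_le\<close> adds the halves.\<close>
    then have e: "e / 2 > 0" by simp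
    show "\<forall>\<^sub>F m in sequentially. \<forall>q\<in>?S. \<forall>h.
        norm ((\<Sum>k<m. sph_term_xi n k (q, s) * fst h + sph_term_mu n k (q, s) * snd h)
          - (sph_series_xi n (q, s) * fst h + sph_series_mu n (q, s) * snd h)) \<le> e * norm h"
      using uniform_limitD[OF lim(2) e] uniform_limitD[OF lim(3) e]
    proof eventually_elim
      case (elim m)
      show ?case
      proof (intro ballI allI)
        fix q h assume "q \<in> ?S"
        then have "(q, s) \<in> ball 0 M \<times> ball 0 M" using M(2) by auto
        then have d: "norm ((\<Sum>k<m. sph_term_xi n k (q, s)) - sph_series_xi n (q, s)) < e / 2"
          "norm ((\<Sum>k<m. sph_term_mu n k (q, s)) - sph_series_mu n (q, s)) < e / 2"
          using elim by (auto simp: dist_norm)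
        have "norm ((\<Sum>k<m. sph_term_xi n k (q, s) * fst h + sph_term_mu n k (q, s) * snd h)
            - (sph_series_xi n (q, s) * fst h + sph_series_mu n (q, s) * snd h))
          = norm (((\<Sum>k<m. sph_term_xi n k (q, s)) - sph_series_xi n (q, s)) * fst h
            + ((\<Sum>k<m. sph_term_mu n k (q, s)) - sph_series_mu n (q, s)) * snd h)"
          by (simp add: sum.distrib sum_distrib_right[symmetric] left_diff_distrib add_diff_add)
        also have "\<dots> \<le> e * norm h"
          by (rule order_trans[OF norm_grad_apply_le mult_right_mono]) (use d in auto)
        finally show "norm ((\<Sum>k<m. sph_term_xi n k (q, s) * fst h + sph_term_mu n k (q, s) * snd h)
            - (sph_series_xi n (q, s) * fst h + sph_series_mu n (q, s) * snd h)) \<le> e * norm h" .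
      qed
    qed
  qed (use M in auto)
  then obtain g where g: "\<And>q. q \<in> ?S \<Longrightarrow> (\<lambda>k. sph_term n k (q, s)) sums g q"
    "\<And>q. q \<in> ?S \<Longrightarrow> (g has_derivative (\<lambda>h. sph_series_xi n (q, s) * fst h
      + sph_series_mu n (q, s) * snd h)) (at q within ?S)" by blast
  have p: "p \<in> ?S" using M by auto
  have "((\<lambda>q. sph_series n (q, s)) has_derivative
    (\<lambda>h. sph_series_xi n (p, s) * fst h + sph_series_mu n (p, s) * snd h)) (at p within ?S)"
    by (rule has_derivative_transform[OF p _ g(2)[OF p]]) (rule sums_unique2[OF sums g(1)])
  then show ?thesis using p by (simp add: at_within_open[OF _ open_ball])
qed

section \<open>Spherical functions in terms of the series\<close>

text \<open>Closed form and recursion both start at 1 and have the same quotient of consecutive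
  terms.\<close>

lemma sph_coeff_eq_sph_term: "sph_coeff n \<xi> \<mu> r k = sph_term n k ((\<xi>, \<mu>), r\<^sup>2)"
proof (induction k)
  case (Suc k)
  have "sph_coeff n \<xi> \<mu> r (Suc k) = sph_ratio n k (\<xi>, \<mu>) (r\<^sup>2) * sph_coeff n \<xi> \<mu> r k"
    by (simp add: sph_coeff_def sph_ratio_def pochhammer_Suc power2_eq_square mult_ac del: of_nat_Suc)
  then show ?case by (simp add: Suc.IH)
qed (simp add: sph_coeff_def)

text \<open>Inversion flips the sign of the real coordinate and keeps the norm of the complex one.
  The two exponentials merge into one whose exponent is linear in \<open>\<mu>\<close>.\<close>

lemma sph_fun_heis_inv:
  fixes x :: "'n::finite heis"
  shows "sph_fun \<xi> \<mu> (heis_inv x) =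
    exp (\<mu> * (- \<i> * of_real (snd x) - of_real ((norm (fst x))\<^sup>2) / 4))
      * sph_series CARD('n) ((\<xi>, \<mu>), (norm (fst x))\<^sup>2)"
proof -
  let ?r = "norm (fst x)"
  have "CARD('n) \<ge> 1" by (simp add: Suc_leI)
  \<comment> \<open>The separate summand 1 is the term of index 0.\<close>
  then have "1 + (\<Sum>k. sph_coeff CARD('n) \<xi> \<mu> ?r (Suc k)) = (\<Sum>k. sph_coeff CARD('n) \<xi> \<mu> ?r k)"
    by (subst suminf_split_head[OF summable_sph_coeff]) (simp_all add: sph_coeff_eq_sph_term)
  then have "1 + (\<Sum>k. sph_coeff CARD('n) \<xi> \<mu> ?r (Suc k))
      = sph_series CARD('n) ((\<xi>, \<mu>), ?r\<^sup>2)"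
    by (simp only: sph_series_def sph_coeff_eq_sph_term)
  moreover have "exp (\<i> * \<mu> * of_real (- snd x)) * exp (- \<mu> * of_real (?r\<^sup>2) / 4)
      = exp (\<mu> * (- \<i> * of_real (snd x) - of_real (?r\<^sup>2) / 4))"
    by (simp add: mult_exp_exp right_diff_distrib mult_ac)
  ultimately show ?thesis
    by (simp only: sph_fun_def heis_inv_def fst_conv snd_conv norm_minus_cancel)
qed

section \<open>Extension of the spherical transform\<close>

theorem proposition4p2:
  fixes f :: "'n::finite heis \<Rightarrow> complex"
    and F :: "complex \<times> complex \<Rightarrow> complex"
  assumes "f \<in> D_rad"
    and "\<forall>\<xi> \<mu>. F (\<xi>, \<mu>) = (LINT x|lborel. f x * sph_fun \<xi> \<mu> (heis_inv x))"
  shows "(\<forall>\<xi> \<mu>. integrable lborel (\<lambda>x. f x * sph_fun \<xi> \<mu> (heis_inv x)))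
    \<and> holomorphic2 F
    \<and> (\<forall>(\<xi>, \<mu>) \<in> heis_fan CARD('n). F (of_real \<xi>, of_real \<mu>) = sph_transform f (\<xi>, \<mu>))"
proof -
  let ?n = "CARD('n)"
  have n: "?n \<ge> 1" by (simp add: Suc_leI)
  have "Ck 0 f" using assms(1) unfolding D_rad_def smooth_def by blast
  then have f: "continuous_on UNIV f" by simp
  define K where "K = closure {x. f x \<noteq> 0}"
  have K: "compact K" using assms(1) by (simp add: D_rad_def K_def)
  have fK: "f x = 0" if "x \<notin> K" for x
    using that closure_subset[of "{x. f x \<noteq> 0}"] by (auto simp: K_def)
  \<comment> \<open>\<open>exp (\<mu> * w x)\<close> is the exponential factor at the inverse of
    \<open>x\<close>, so differentiating it in \<open>\<mu>\<close> multiplies it by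
    \<open>w x\<close>.\<close>
  define w :: "'n heis \<Rightarrow> complex"
    where "w x = - \<i> * of_real (snd x) - of_real ((norm (fst x))\<^sup>2) / 4" for x
  define s :: "'n heis \<Rightarrow> real" where "s x = (norm (fst x))\<^sup>2" for x
  \<comment> \<open>With \<open>f\<close> absorbed into \<open>E\<close>, everything built from
    \<open>E\<close> vanishes when the point is outside \<open>K\<close>.\<close>
  define E where "E y = f (snd y) * exp (snd (fst y) * w (snd y))"
    for y :: "(complex \<times> complex) \<times> 'n heis"
  define G where "G p x = E (p, x) * sph_series ?n (p, s x)" for p x
  \<comment> \<open>\<open>a\<close> and \<open>b\<close> are the partial derivatives of
    \<open>G\<close>. The exponential does not involve \<open>\<xi>\<close>, so only
    \<open>b\<close> carries a term with \<open>w\<close>.\<close>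
  define a where "a y = E y * sph_series_xi ?n (fst y, s (snd y))" for y
  define b where "b y = E y * (w (snd y) * sph_series ?n (fst y, s (snd y))
    + sph_series_mu ?n (fst y, s (snd y)))" for y
  have G_eq: "f x * sph_fun (fst p) (snd p) (heis_inv x) = G p x" for p x
    by (simp add: sph_fun_heis_inv G_def E_def w_def s_def mult.assoc)
  have w: "continuous_on S w" for S
    unfolding w_def[abs_def] divide_inverse by (intro continuous_intros)
  have s: "continuous_on S s" for S
    unfolding s_def[abs_def] by (intro continuous_intros)
  have E: "continuous_on UNIV E"
    unfolding E_def[abs_def]
    by (intro continuous_intros continuous_on_compose2[OF f] continuous_on_compose2[OF w]) auto
  have y: "continuous_on UNIV (\<lambda>y. (fst y, s (snd y)))"
    by (intro continuous_intros continuous_on_compose2[OF s]) auto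
  note cont = continuous_on_compose2[OF continuous_on_UNIV_sph_series(1)[OF n] y subset_UNIV]
    continuous_on_compose2[OF continuous_on_UNIV_sph_series(2)[OF n] y subset_UNIV]
    continuous_on_compose2[OF continuous_on_UNIV_sph_series(3)[OF n] y subset_UNIV]
  have a: "continuous_on UNIV a"
    unfolding a_def[abs_def] by (intro continuous_intros E cont)
  have b: "continuous_on UNIV b"
    unfolding b_def[abs_def]
    by (intro continuous_intros E cont continuous_on_compose2[OF w[of UNIV]]) auto
  have G: "continuous_on UNIV (G p)" for p
  proof -
    have "continuous_on UNIV (\<lambda>y. E y * sph_series ?n (fst y, s (snd y)))"
      by (intro continuous_intros E cont)
    then have "continuous_on UNIV (\<lambda>x. (\<lambda>y. E y * sph_series ?n (fst y, s (snd y))) (p, x))"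
      by (rule continuous_on_compose2) (auto intro!: continuous_intros)
    then show ?thesis by (simp add: G_def[abs_def])
  qed
  have GK: "G p x = 0" if "x \<notin> K" for p x
    using fK[OF that] by (simp add: G_def E_def)
  have deriv: "((\<lambda>p. G p x) has_derivative (\<lambda>h. a (p, x) * fst h + b (p, x) * snd h)) (at p)" for p x
  proof -
    have "((\<lambda>p. snd p * w x) has_derivative (\<lambda>h. snd h * w x)) (at p)"
      by (auto intro!: derivative_eq_intros)
    from has_derivative_compose[OF this DERIV_exp[unfolded has_field_derivative_def]]
    have e: "((\<lambda>p. exp (snd p * w x)) has_derivative (\<lambda>h. exp (snd p * w x) * (snd h * w x))) (at p)" .
    have "((\<lambda>p. f x * exp (snd p * w x)) has_derivative
        (\<lambda>h. f x * (exp (snd p * w x) * (snd h * w x)))) (at p)"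
      by (intro has_derivative_mult_right e)
    from has_derivative_mult[OF this sph_series_has_derivative[OF n, of "s x"]]
    have "((\<lambda>p. G p x) has_derivative (\<lambda>h. f x * exp (snd p * w x) *
            (sph_series_xi ?n (p, s x) * fst h + sph_series_mu ?n (p, s x) * snd h)
          + f x * (exp (snd p * w x) * (snd h * w x)) * sph_series ?n (p, s x))) (at p)"
      by (simp only: G_def E_def fst_conv snd_conv)
    also have "(\<lambda>h. f x * exp (snd p * w x) *
            (sph_series_xi ?n (p, s x) * fst h + sph_series_mu ?n (p, s x) * snd h)
          + f x * (exp (snd p * w x) * (snd h * w x)) * sph_series ?n (p, s x))
        = (\<lambda>h. a (p, x) * fst h + b (p, x) * snd h)"
      unfolding a_def b_def E_def by (rule ext) (simp only: fst_conv snd_conv, algebra)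
    finally show ?thesis .
  qed
  have "F = (\<lambda>p. LINT x|lborel. G p x)"
  proof
    fix p
    show "F p = (LINT x|lborel. G p x)"
      using assms(2)[rule_format, of "fst p" "snd p"] by (simp only: G_eq prod.collapse)
  qed
  then have "holomorphic2 F"
    by (simp only:) (rule holomorphic2_integral[OF K GK G deriv a b])
  moreover have "integrable lborel (\<lambda>x. f x * sph_fun \<xi> \<mu> (heis_inv x))" for \<xi> \<mu>
    unfolding G_eq[where p = "(\<xi>, \<mu>)", unfolded fst_conv snd_conv]
    by (rule integrable_lborel_compact_support[OF K G GK])
  \<comment> \<open>At real parameters both sides are the same integral by definition; the content
    of the extension is the holomorphy.\<close>
  moreover have "F (of_real \<xi>, of_real \<mu>) = sph_transform f (\<xi>, \<mu>)" for \<xi> \<mu>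
    using assms(2) by (simp only: sph_transform_def fst_conv snd_conv)
  ultimately show ?thesis by blast
qed

end
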